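(* Let $\mathcal P$ be a locally geometric poset with a translative action of a group $G$, and let $\mathcal Q$ be a $G$-invariant subposet of $\mathcal P$ (i.e. $G\mathcal Q=\mathcal Q$). If $\mathcal Q$ is an M-ideal of $\mathcal P$, then $\mathcal Q/G$ is an M-ideal of $\mathcal P/G$. Moreover, if $\mathcal P$ satisfies condition $(\ddagger\ddagger)$, the converse also holds.
   Context: An action of $G$ on a poset $\mathcal P$ is a homomorphism $G\to\operatorname{Aut}(\mathcal P)$. In a poset, $x\vee y$ is the set of minimal common upper bounds and $\bigvee I$ the set of minimal upper bounds of a subset $I$. The action is translative if for all $x\in\mathcal P$, $g\in G$: $x\vee gx\neq\emptyset$ implies $x=gx$. $\mathcal P/G=\{Gx:x\in\mathcal P\}$ is the set of orbits, ordered by $Gx\le Gy$ iff $x\le gy$ for some $g\in G$ (a partial order when the action is translative, and then $\mathcal P/G$ is again locally geometric); $\mathcal Q/G$ is the set of orbits of elements of $\mathcal Q$. A geometric lattice is a chain-finite lattice in which $y$ covers $x$ iff $y=x\vee a$ for an atom $a\not\le x$; an element is modular if its complements form an antichain. A locally geometric poset is graded, bounded below (minimum $\hat0$, rank $\operatorname{rk}$), with each $\mathcal P_{\le x}$ a geometric lattice; $A(\mathcal P)$ is its set of atoms. Condition $(\ddagger\ddagger)$: for all $x,y\in\mathcal P$ with $\operatorname{rk}(x)<\operatorname{rk}(y)$ and every $I\subseteq A(\mathcal P)$ with $y\in\bigvee I$ and $|I|=\operatorname{rk}(y)$, there is $a\in I$ with $a\not\le x$ and $a\vee x\ne\emptyset$.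 An order ideal $\mathcal Q$ is pure if its maximal elements share a rank, join-closed if $T\subseteq\mathcal Q\Rightarrow\bigvee T\subseteq\mathcal Q$. An M-ideal of $\mathcal P$ is a pure join-closed order ideal $\mathcal Q$ with (M1) if $y\in\mathcal Q$, $a\in A(\mathcal P)$, $a\vee y=\emptyset$ then $a\in\mathcal Q$; (M2) for every maximal $x\in\mathcal P$ some maximal $y\in\mathcal Q$ is modular in $\mathcal P_{\le x}$. *)

theory Defs
  imports "HOL-Algebra.Lattice" "HOL-Algebra.Group_Action"
begin

section \<open>Locally geometric posets\<close>

definition min_upper_bounds :: "('a, 'm) gorder_scheme \<Rightarrow> 'a set \<Rightarrow> 'a set" where
  "min_upper_bounds P I =
     {u \<in> Upper P I. \<forall>v \<in> Upper P I. v \<sqsubseteq>\<^bsub>P\<^esub> u \<longrightarrow> v = u}"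

definition join_set :: "('a, 'm) gorder_scheme \<Rightarrow> 'a \<Rightarrow> 'a \<Rightarrow> 'a set" where
  "join_set P x y = min_upper_bounds P {x, y}"

definition maximal_elements :: "('a, 'm) gorder_scheme \<Rightarrow> 'a set \<Rightarrow> 'a set" where
  "maximal_elements P S = {x \<in> S. \<forall>y \<in> S. x \<sqsubseteq>\<^bsub>P\<^esub> y \<longrightarrow> y = x}"

definition down_poset :: "('a, 'm) gorder_scheme \<Rightarrow> 'a \<Rightarrow> ('a, 'm) gorder_scheme" where
  "down_poset P x = P\<lparr>carrier := {y \<in> carrier P. y \<sqsubseteq>\<^bsub>P\<^esub> x}\<rparr>"

definition covers :: "('a, 'm) gorder_scheme \<Rightarrow> 'a \<Rightarrow> 'a \<Rightarrow> bool" where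
  "covers P y x \<longleftrightarrow> x \<in> carrier P \<and> y \<in> carrier P \<and> x \<sqsubset>\<^bsub>P\<^esub> y \<and>
     \<not> (\<exists>z \<in> carrier P. x \<sqsubset>\<^bsub>P\<^esub> z \<and> z \<sqsubset>\<^bsub>P\<^esub> y)"

definition atoms :: "('a, 'm) gorder_scheme \<Rightarrow> 'a set" where
  "atoms P = {a \<in> carrier P. covers P a \<bottom>\<^bsub>P\<^esub>}"

definition chain_finite :: "('a, 'm) gorder_scheme \<Rightarrow> bool" where
  "chain_finite P \<longleftrightarrow> (\<forall>C. pred_on.chain (carrier P) (lless P) C \<longrightarrow> finite C)"

definition geometric_lattice :: "('a, 'm) gorder_scheme \<Rightarrow> bool" where
  "geometric_lattice L \<longleftrightarrow> lattice L \<and> chain_finite L \<and>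
     (\<forall>x \<in> carrier L. \<forall>y \<in> carrier L.
        covers L y x \<longleftrightarrow> (\<exists>a \<in> atoms L. \<not> a \<sqsubseteq>\<^bsub>L\<^esub> x \<and> y = x \<squnion>\<^bsub>L\<^esub> a))"

definition complements :: "('a, 'm) gorder_scheme \<Rightarrow> 'a \<Rightarrow> 'a set" where
  "complements L x =
     {z \<in> carrier L. x \<squnion>\<^bsub>L\<^esub> z = \<top>\<^bsub>L\<^esub> \<and> x \<sqinter>\<^bsub>L\<^esub> z = \<bottom>\<^bsub>L\<^esub>}"

definition antichain :: "('a, 'm) gorder_scheme \<Rightarrow> 'a set \<Rightarrow> bool" where
  "antichain P S \<longleftrightarrow> (\<forall>x \<in> S. \<forall>y \<in> S. x \<sqsubseteq>\<^bsub>P\<^esub> y \<longrightarrow> x = y)"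

definition modular_element :: "('a, 'm) gorder_scheme \<Rightarrow> 'a \<Rightarrow> bool" where
  "modular_element L x \<longleftrightarrow> x \<in> carrier L \<and> antichain L (complements L x)"

definition maximal_chain :: "('a, 'm) gorder_scheme \<Rightarrow> 'a set \<Rightarrow> bool" where
  "maximal_chain P C \<longleftrightarrow> pred_on.maxchain (carrier P) (lless P) C"

text \<open>A poset is graded if, for each element \<open>x\<close>, all maximal chains of \<open>P\<^sub>\<le>\<^sub>x\<close> are
  finite and of the same length (number of elements minus one); \<open>rk\<close> is that length.\<close>

definition graded_poset :: "('a, 'm) gorder_scheme \<Rightarrow> bool" where
  "graded_poset P \<longleftrightarrow> (\<forall>x \<in> carrier P. \<forall>C D.
     maximal_chain (down_poset P x) C \<and> maximal_chain (down_poset P x) D \<longrightarrow>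
     finite C \<and> finite D \<and> card C = card D)"

definition rk :: "('a, 'm) gorder_scheme \<Rightarrow> 'a \<Rightarrow> nat" where
  "rk P x = (THE n. \<forall>C. maximal_chain (down_poset P x) C \<longrightarrow> card C = Suc n)"

definition locally_geometric :: "('a, 'm) gorder_scheme \<Rightarrow> bool" where
  "locally_geometric P \<longleftrightarrow> partial_order P \<and> (\<exists>b. least P b (carrier P)) \<and>
     graded_poset P \<and> (\<forall>x \<in> carrier P. geometric_lattice (down_poset P x))"

text \<open>The condition written with two double daggers.\<close>

definition double_dagger_condition :: "('a, 'm) gorder_scheme \<Rightarrow> bool" where
  "double_dagger_condition P \<longleftrightarrow>
     (\<forall>x \<in> carrier P. \<forall>y \<in> carrier P. \<forall>I. rk P x < rk P y \<longrightarrow>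
        I \<subseteq> atoms P \<longrightarrow> y \<in> min_upper_bounds P I \<longrightarrow> finite I \<longrightarrow> card I = rk P y \<longrightarrow>
        (\<exists>a \<in> I. \<not> a \<sqsubseteq>\<^bsub>P\<^esub> x \<and> join_set P a x \<noteq> {}))"


section \<open>M-ideals\<close>

definition order_ideal :: "('a, 'm) gorder_scheme \<Rightarrow> 'a set \<Rightarrow> bool" where
  "order_ideal P Q \<longleftrightarrow> Q \<subseteq> carrier P \<and>
     (\<forall>y \<in> Q. \<forall>x \<in> carrier P. x \<sqsubseteq>\<^bsub>P\<^esub> y \<longrightarrow> x \<in> Q)"

definition pure_ideal :: "('a, 'm) gorder_scheme \<Rightarrow> 'a set \<Rightarrow> bool" where
  "pure_ideal P Q \<longleftrightarrow>
     (\<forall>x \<in> maximal_elements P Q. \<forall>y \<in> maximal_elements P Q. rk P x = rk P y)"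

definition join_closed :: "('a, 'm) gorder_scheme \<Rightarrow> 'a set \<Rightarrow> bool" where
  "join_closed P Q \<longleftrightarrow> (\<forall>T. T \<subseteq> Q \<longrightarrow> min_upper_bounds P T \<subseteq> Q)"

definition M_ideal :: "('a, 'm) gorder_scheme \<Rightarrow> 'a set \<Rightarrow> bool" where
  "M_ideal P Q \<longleftrightarrow> order_ideal P Q \<and> pure_ideal P Q \<and> join_closed P Q \<and>
     (\<forall>y \<in> Q. \<forall>a \<in> atoms P. join_set P a y = {} \<longrightarrow> a \<in> Q) \<and>
     (\<forall>x \<in> maximal_elements P (carrier P). \<exists>y \<in> maximal_elements P Q.
        modular_element (down_poset P x) y)"


section \<open>Translative actions and quotients\<close>

text \<open>A homomorphism into the group of bijections of the carrier all of whose values are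
  order automorphisms.\<close>

definition poset_action ::
  "('g, 'n) monoid_scheme \<Rightarrow> ('a, 'm) gorder_scheme \<Rightarrow> ('g \<Rightarrow> 'a \<Rightarrow> 'a) \<Rightarrow> bool" where
  "poset_action G P \<phi> \<longleftrightarrow>
     group_action G (carrier P) \<phi> \<and> (\<forall>g \<in> carrier G. order_emb P P (\<phi> g))"

definition translative_action ::
  "('g, 'n) monoid_scheme \<Rightarrow> ('a, 'm) gorder_scheme \<Rightarrow> ('g \<Rightarrow> 'a \<Rightarrow> 'a) \<Rightarrow> bool" where
  "translative_action G P \<phi> \<longleftrightarrow> poset_action G P \<phi> \<and>
     (\<forall>x \<in> carrier P. \<forall>g \<in> carrier G. join_set P x (\<phi> g x) \<noteq> {} \<longrightarrow> x = \<phi> g x)"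

definition quotient_poset ::
  "('g, 'n) monoid_scheme \<Rightarrow> ('a, 'm) gorder_scheme \<Rightarrow> ('g \<Rightarrow> 'a \<Rightarrow> 'a) \<Rightarrow> 'a set gorder" where
  "quotient_poset G P \<phi> =
     \<lparr>carrier = orbits G (carrier P) \<phi>,
      eq = (=),
      le = (\<lambda>X Y. \<exists>x \<in> carrier P. \<exists>y \<in> carrier P.
              X = orbit G \<phi> x \<and> Y = orbit G \<phi> y \<and> (\<exists>g \<in> carrier G. x \<sqsubseteq>\<^bsub>P\<^esub> \<phi> g y))\<rparr>"

end

theory Submission
  imports Defs
begin

text \<open>Below a fixed \<open>u\<close>, translativity makes \<open>x \<mapsto> G x\<close> an isomorphism of \<open>P\<^sub>\<le>\<^sub>u\<close> onto \<open>(P/G)\<^sub>\<le>\<^sub>G\<^sub>u\<close>.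
  Rank, minimal upper bounds, atoms, maximality and modularity are therefore shared by \<open>P\<close> and \<open>P/G\<close>,
  and every clause of the definition of an M-ideal transfers in both directions except (M1): two
  orbits may have a join although the given representatives do not. There the double dagger
  condition moves a join with a translate of \<open>y\<close> to a join with \<open>y\<close> itself.\<close>

section \<open>Order isomorphisms\<close>

text \<open>Two features of the setting shape the development. A join in P is a set of minimal upper
  bounds, which may be empty or have several members, while the geometric axioms concern the lattice
  operations below one element. Arguments are therefore carried out below a chosen common upper
  bound, and \<open>common_upper_bound_join\<close> passes between the two notions. Moreover bottom,
  top, join, meet and rank are choice or description terms, so their invariance under isomorphism
  rests on existence in the source and antisymmetry in the target. The double dagger condition
  accepts only sets of exactly rk(y) atoms having y as a minimal upper bound. Such bases are built
  along covers, each cover contributing one atom.\<close>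

locale order_iso = L: partial_order L + M: partial_order M
  for L :: "('a, 'm) gorder_scheme" and M :: "('b, 'n) gorder_scheme" +
  fixes f :: "'a \<Rightarrow> 'b"
  assumes bij: "bij_betw f (carrier L) (carrier M)"
    and le_iff: "x \<in> carrier L \<Longrightarrow> y \<in> carrier L \<Longrightarrow> f x \<sqsubseteq>\<^bsub>M\<^esub> f y \<longleftrightarrow> x \<sqsubseteq>\<^bsub>L\<^esub> y"
begin

lemma image_carrier: "f ` carrier L = carrier M"
  using bij by (simp add: bij_betw_def)

lemma closed: "x \<in> carrier L \<Longrightarrow> f x \<in> carrier M"
  using image_carrier by blast

lemma eq_iff: "x \<in> carrier L \<Longrightarrow> y \<in> carrier L \<Longrightarrow> f x = f y \<longleftrightarrow> x = y"
  using bij by (meson bij_betw_def inj_on_eq_iff)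

text \<open>Upgrades one-sided statements about isomorphisms to equalities, as in
  \<open>maximal_chain_cards\<close>.\<close>

lemma inverse: "order_iso M L (inv_into (carrier L) f)"
proof
  show "bij_betw (inv_into (carrier L) f) (carrier M) (carrier L)"
    using bij by (rule bij_betw_inv_into)
  fix x y assume "x \<in> carrier M" "y \<in> carrier M"
  then show "inv_into (carrier L) f x \<sqsubseteq>\<^bsub>L\<^esub> inv_into (carrier L) f y \<longleftrightarrow> x \<sqsubseteq>\<^bsub>M\<^esub> y"
    by (metis f_inv_into_f image_carrier inv_into_into le_iff)
qed

lemma Upper_image:
  assumes "A \<subseteq> carrier L"
  shows "Upper M (f ` A) = f ` Upper L A"
proof -
  have "Upper M (f ` A) = {u \<in> f ` carrier L. \<forall>x\<in>A. f x \<sqsubseteq>\<^bsub>M\<^esub> u}"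
    unfolding Upper_def using assms closed image_carrier by auto
  also have "\<dots> = f ` {u \<in> carrier L. \<forall>x\<in>A. x \<sqsubseteq>\<^bsub>L\<^esub> u}"
    using assms le_iff by (auto simp: subset_iff)
  also have "{u \<in> carrier L. \<forall>x\<in>A. x \<sqsubseteq>\<^bsub>L\<^esub> u} = Upper L A"
    unfolding Upper_def using assms by auto
  finally show ?thesis .
qed

lemma Lower_image:
  assumes "A \<subseteq> carrier L"
  shows "Lower M (f ` A) = f ` Lower L A"
proof -
  have "Lower M (f ` A) = {u \<in> f ` carrier L. \<forall>x\<in>A. u \<sqsubseteq>\<^bsub>M\<^esub> f x}"
    unfolding Lower_def using assms closed image_carrier by auto
  also have "\<dots> = f ` {u \<in> carrier L. \<forall>x\<in>A. u \<sqsubseteq>\<^bsub>L\<^esub> x}"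
    using assms le_iff by (auto simp: subset_iff)
  also have "{u \<in> carrier L. \<forall>x\<in>A. u \<sqsubseteq>\<^bsub>L\<^esub> x} = Lower L A"
    unfolding Lower_def using assms by auto
  finally show ?thesis .
qed

lemma least_image: "least L x A \<Longrightarrow> least M (f x) (f ` A)"
  unfolding least_def image_carrier[symmetric] by (auto simp: le_iff subset_iff)

lemma greatest_image: "greatest L x A \<Longrightarrow> greatest M (f x) (f ` A)"
  unfolding greatest_def image_carrier[symmetric] by (auto simp: le_iff subset_iff)

text \<open>The lattice \<open>L\<close> supplies a least upper bound. Its image is least in
  \<open>M\<close>, and antisymmetry of \<open>M\<close> makes the chosen element there equal to
  it.\<close>

lemma join_image:
  assumes "lattice L" "x \<in> carrier L" "y \<in> carrier L"
  shows "f x \<squnion>\<^bsub>M\<^esub> f y = f (x \<squnion>\<^bsub>L\<^esub> y)"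
proof -
  interpret lattice L by fact
  have "least L (x \<squnion>\<^bsub>L\<^esub> y) (Upper L {x, y})"
    unfolding join_def using assms by (intro sup_of_two_least)
  then have "least M (f (x \<squnion>\<^bsub>L\<^esub> y)) (Upper M {f x, f y})"
    using least_image Upper_image[of "{x, y}"] assms by auto
  then show ?thesis
    unfolding join_def[of M] sup_def by (metis M.least_unique someI_ex)
qed

lemma meet_image:
  assumes "lattice L" "x \<in> carrier L" "y \<in> carrier L"
  shows "f x \<sqinter>\<^bsub>M\<^esub> f y = f (x \<sqinter>\<^bsub>L\<^esub> y)"
proof -
  interpret lattice L by fact
  have "greatest L (x \<sqinter>\<^bsub>L\<^esub> y) (Lower L {x, y})"
    unfolding meet_def using assms by (intro inf_of_two_greatest)
  then have "greatest M (f (x \<sqinter>\<^bsub>L\<^esub> y)) (Lower M {f x, f y})"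
    using greatest_image Lower_image[of "{x, y}"] assms by auto
  then show ?thesis
    unfolding meet_def[of M] inf_def by (metis M.greatest_unique someI_ex)
qed

lemma bottom_image:
  assumes "least L b (carrier L)"
  shows "\<bottom>\<^bsub>M\<^esub> = f \<bottom>\<^bsub>L\<^esub>"
  using least_image[OF assms] assms unfolding bottom_def image_carrier
  by (metis M.least_unique L.least_unique someI_ex)

lemma top_image:
  assumes "greatest L t (carrier L)"
  shows "\<top>\<^bsub>M\<^esub> = f \<top>\<^bsub>L\<^esub>"
  using greatest_image[OF assms] assms unfolding top_def image_carrier
  by (metis M.greatest_unique L.greatest_unique someI_ex)

lemma complements_image:
  assumes "lattice L" "least L b (carrier L)" "greatest L t (carrier L)" "x \<in> carrier L"
  shows "complements M (f x) = f ` complements L x"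
proof -
  interpret lattice L by fact
  \<comment> \<open>Membership in the carrier is what allows \<open>f\<close> to be cancelled in the
    two equations defining a complement.\<close>
  have "\<bottom>\<^bsub>L\<^esub> \<in> carrier L" "\<top>\<^bsub>L\<^esub> \<in> carrier L"
    unfolding bottom_def top_def using assms(2,3) by (metis least_closed greatest_closed someI_ex)+
  then have "x \<squnion>\<^bsub>L\<^esub> z = \<top>\<^bsub>L\<^esub> \<and> x \<sqinter>\<^bsub>L\<^esub> z = \<bottom>\<^bsub>L\<^esub> \<longleftrightarrow>
      f x \<squnion>\<^bsub>M\<^esub> f z = \<top>\<^bsub>M\<^esub> \<and> f x \<sqinter>\<^bsub>M\<^esub> f z = \<bottom>\<^bsub>M\<^esub>" if "z \<in> carrier L" for z
    using assms that
    by (simp add: join_image meet_image bottom_image[OF assms(2)] top_image[OF assms(3)] eq_iff)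
  then show ?thesis
    unfolding complements_def image_carrier[symmetric] by blast
qed

lemma modular_element_image_iff:
  assumes "lattice L" "least L b (carrier L)" "greatest L t (carrier L)" "x \<in> carrier L"
  shows "modular_element M (f x) \<longleftrightarrow> modular_element L x"
proof -
  have "complements L x \<subseteq> carrier L" by (auto simp: complements_def)
  then show ?thesis
    unfolding modular_element_def antichain_def complements_image[OF assms]
    using assms(4) closed by (auto simp: le_iff eq_iff subset_iff)
qed

end

section \<open>Maximal chains and rank\<close>

text \<open>A chain that can be enlarged at all can be enlarged by a single element, so maximality
  becomes a condition on elements instead of on larger chains. In this form it transfers along
  bijections and can be checked for explicit chains.\<close>

lemma (in partial_order) maximal_chain_iff:
  "maximal_chain L C \<longleftrightarrow> C \<subseteq> carrier L \<and> (\<forall>x\<in>C. \<forall>y\<in>C. x \<sqsubseteq> y \<or> y \<sqsubseteq> x) \<and>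
     (\<forall>z\<in>carrier L. (\<forall>x\<in>C. x \<sqsubseteq> z \<or> z \<sqsubseteq> x) \<longrightarrow> z \<in> C)" (is "_ \<longleftrightarrow> ?R")
proof -
  have chain: "pred_on.chain (carrier L) (lless L) D \<longleftrightarrow>
      D \<subseteq> carrier L \<and> (\<forall>x\<in>D. \<forall>y\<in>D. x \<sqsubseteq> y \<or> y \<sqsubseteq> x)" for D
    unfolding pred_on.chain_def lless_def eq_is_equal sup_apply sup_bool_def
    using le_refl by (metis subsetD)
  show ?thesis
  proof
    assume max: "maximal_chain L C"
    then have C: "C \<subseteq> carrier L" "\<forall>x\<in>C. \<forall>y\<in>C. x \<sqsubseteq> y \<or> y \<sqsubseteq> x"
      unfolding maximal_chain_def pred_on.maxchain_def chain by auto
    have "z \<in> C" if "z \<in> carrier L" "\<forall>x\<in>C. x \<sqsubseteq> z \<or> z \<sqsubseteq> x" for z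
    proof (rule ccontr)
      assume "z \<notin> C"
      moreover have "pred_on.chain (carrier L) (lless L) (insert z C)"
        unfolding chain using C that by auto
      ultimately show False
        using max unfolding maximal_chain_def pred_on.maxchain_def by blast
    qed
    with C show ?R by blast
  next
    assume R: ?R
    have "D \<subseteq> C" if "D \<subseteq> carrier L" "\<forall>x\<in>D. \<forall>y\<in>D. x \<sqsubseteq> y \<or> y \<sqsubseteq> x" "C \<subseteq> D" for D
    proof
      fix z assume "z \<in> D"
      then have "z \<in> carrier L" "\<forall>x\<in>C. x \<sqsubseteq> z \<or> z \<sqsubseteq> x" using that by auto
      with R show "z \<in> C" by blast
    qed
    then have "\<nexists>D. pred_on.chain (carrier L) (lless L) D \<and> C \<subset> D"
      unfolding chain by (metis psubset_eq subset_antisym)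
    moreover have "pred_on.chain (carrier L) (lless L) C" unfolding chain using R by simp
    ultimately show "maximal_chain L C"
      unfolding maximal_chain_def pred_on.maxchain_def by simp
  qed
qed

text \<open>The Hausdorff maximal principle, valid for any relation on the carrier.\<close>

lemma maximal_chain_exists: "\<exists>C. maximal_chain P C"
  unfolding maximal_chain_def by (rule pred_on.Hausdorff)

lemma (in order_iso) maximal_chain_image:
  assumes "maximal_chain L C"
  shows "maximal_chain M (f ` C)"
proof -
  have C: "C \<subseteq> carrier L" "\<forall>x\<in>C. \<forall>y\<in>C. x \<sqsubseteq>\<^bsub>L\<^esub> y \<or> y \<sqsubseteq>\<^bsub>L\<^esub> x"
    "\<And>z. z \<in> carrier L \<Longrightarrow> \<forall>x\<in>C. x \<sqsubseteq>\<^bsub>L\<^esub> z \<or> z \<sqsubseteq>\<^bsub>L\<^esub> x \<Longrightarrow> z \<in> C"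
    using assms unfolding L.maximal_chain_iff by auto
  have "f z \<in> f ` C" if "z \<in> carrier L" "\<forall>x\<in>C. f x \<sqsubseteq>\<^bsub>M\<^esub> f z \<or> f z \<sqsubseteq>\<^bsub>M\<^esub> f x" for z
    using C(1) that le_iff by (intro imageI C(3)) blast+
  moreover have "\<forall>x\<in>C. \<forall>y\<in>C. f x \<sqsubseteq>\<^bsub>M\<^esub> f y \<or> f y \<sqsubseteq>\<^bsub>M\<^esub> f x"
    using C(1,2) by (auto simp: le_iff subset_iff)
  ultimately show ?thesis
    unfolding M.maximal_chain_iff image_carrier[symmetric] ball_simps using C(1)
    by (intro conjI image_mono ballI impI) simp_all
qed

lemma (in order_iso) maximal_chain_cards:
  "card ` {C. maximal_chain L C} = card ` {C. maximal_chain M C}"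
proof -
  \<comment> \<open>Stated for arbitrary types, so that it applies both to \<open>f\<close> and to
    its inverse.\<close>
  have "card ` {C. maximal_chain K C} \<subseteq> card ` {C. maximal_chain N C}" if "order_iso K N h"
    for K :: "('x, 'k) gorder_scheme" and N :: "('y, 'l) gorder_scheme" and h
  proof -
    interpret h: order_iso K N h by fact
    have "card C = card (h ` C)" if "maximal_chain K C" for C
      using that h.bij unfolding h.L.maximal_chain_iff
      by (metis bij_betw_def card_image inj_on_subset)
    then show ?thesis using h.maximal_chain_image by blast
  qed
  from this[OF inverse] this[OF order_iso_axioms] show ?thesis by blast
qed

text \<open>The predicate inside the description defining \<open>rk\<close> depends only on the set
  of cardinalities of maximal chains, so both ranks are described by the same predicate.\<close>

lemma rk_eq_if_order_iso:
  assumes "order_iso (down_poset P x) (down_poset R y) f"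
  shows "rk P x = rk R y"
proof -
  have "(\<forall>C. maximal_chain K C \<longrightarrow> card C = k) \<longleftrightarrow> card ` {C. maximal_chain K C} \<subseteq> {k}"
    for K :: "('x, 'k) gorder_scheme" and k by auto
  note this[of "down_poset P x"] this[of "down_poset R y"]
  then show ?thesis 
    by (simp add: rk_def order_iso.maximal_chain_cards[OF assms])
qed


section \<open>Locally geometric posets\<close>

lemma down_poset_simps [simp]:
  "carrier (down_poset P x) = {y \<in> carrier P. y \<sqsubseteq>\<^bsub>P\<^esub> x}"
  "y \<sqsubseteq>\<^bsub>down_poset P x\<^esub> z \<longleftrightarrow> y \<sqsubseteq>\<^bsub>P\<^esub> z"
  "y \<sqsubset>\<^bsub>down_poset P x\<^esub> z \<longleftrightarrow> y \<sqsubset>\<^bsub>P\<^esub> z"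
  by (simp_all add: down_poset_def lless_def)

lemma partial_order_down_poset:
  assumes "partial_order P"
  shows "partial_order (down_poset P x)"
proof -
  interpret partial_order P by fact
  show ?thesis
    by unfold_locales
      (auto simp: down_poset_def eq_is_equal intro: le_trans le_antisym)
qed

lemma mem_min_upper_bounds_iff:
  assumes "I \<subseteq> carrier P"
  shows "u \<in> min_upper_bounds P I \<longleftrightarrow> u \<in> carrier P \<and> (\<forall>i\<in>I. i \<sqsubseteq>\<^bsub>P\<^esub> u) \<and>
    (\<forall>v\<in>carrier P. (\<forall>i\<in>I. i \<sqsubseteq>\<^bsub>P\<^esub> v) \<longrightarrow> v \<sqsubseteq>\<^bsub>P\<^esub> u \<longrightarrow> v = u)"
  using assms unfolding min_upper_bounds_def Upper_def by blast

lemma mem_join_set_iff: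
  assumes "x \<in> carrier P" "y \<in> carrier P"
  shows "u \<in> join_set P x y \<longleftrightarrow> u \<in> carrier P \<and> x \<sqsubseteq>\<^bsub>P\<^esub> u \<and> y \<sqsubseteq>\<^bsub>P\<^esub> u \<and>
    (\<forall>v\<in>carrier P. x \<sqsubseteq>\<^bsub>P\<^esub> v \<longrightarrow> y \<sqsubseteq>\<^bsub>P\<^esub> v \<longrightarrow> v \<sqsubseteq>\<^bsub>P\<^esub> u \<longrightarrow> v = u)"
  using assms by (simp add: join_set_def mem_min_upper_bounds_iff imp_conjL)

lemma join_set_commute: "join_set P x y = join_set P y x"
  by (simp add: join_set_def insert_commute)

locale locally_geometric_poset =
  fixes P :: "('a, 'm) gorder_scheme"
  assumes locally_geometric: "locally_geometric P"

sublocale locally_geometric_poset \<subseteq> partial_order P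
  using locally_geometric by (simp add: locally_geometric_def)

context locally_geometric_poset
begin

declare le_antisym [rule del]

lemma bottom_is_least: "least P \<bottom>\<^bsub>P\<^esub> (carrier P)"
  using locally_geometric unfolding locally_geometric_def bottom_def by (meson someI_ex)

lemma bottom_carrier: "\<bottom>\<^bsub>P\<^esub> \<in> carrier P"
  using bottom_is_least by (rule least_closed)

lemma bottom_le: "x \<in> carrier P \<Longrightarrow> \<bottom>\<^bsub>P\<^esub> \<sqsubseteq>\<^bsub>P\<^esub> x"
  using bottom_is_least by (rule least_le)

lemma le_bottom_iff: "x \<in> carrier P \<Longrightarrow> x \<sqsubseteq>\<^bsub>P\<^esub> \<bottom>\<^bsub>P\<^esub> \<longleftrightarrow> x = \<bottom>\<^bsub>P\<^esub>"
  using bottom_carrier bottom_le[of x] le_antisym[of x "\<bottom>\<^bsub>P\<^esub>"] by auto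

lemma atom_carrier: "a \<in> atoms P \<Longrightarrow> a \<in> carrier P"
  by (simp add: atoms_def)

section \<open>The lattices below an element\<close>

lemma down_partial_order: "partial_order (down_poset P x)"
  by (intro partial_order_down_poset partial_order_axioms)

lemma down_geometric: "x \<in> carrier P \<Longrightarrow> geometric_lattice (down_poset P x)"
  using locally_geometric by (simp add: locally_geometric_def)

lemma down_lattice: "x \<in> carrier P \<Longrightarrow> lattice (down_poset P x)"
  using down_geometric by (simp add: geometric_lattice_def)

lemma down_least:
  "x \<in> carrier P \<Longrightarrow> least (down_poset P x) \<bottom>\<^bsub>P\<^esub> (carrier (down_poset P x))"
  by (auto simp: least_def bottom_carrier bottom_le)

lemma down_greatest:
  "x \<in> carrier P \<Longrightarrow> greatest (down_poset P x) x (carrier (down_poset P x))"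
  by (auto simp: greatest_def)

lemma bottom_down: "x \<in> carrier P \<Longrightarrow> \<bottom>\<^bsub>down_poset P x\<^esub> = \<bottom>\<^bsub>P\<^esub>"
  unfolding bottom_def[of "down_poset P x"]
  by (metis down_least down_partial_order partial_order.least_unique someI_ex)

text \<open>Everything below \<open>y\<close> is also below \<open>w\<close>, so the interval
  contains every element that could separate \<open>x\<close> from \<open>y\<close>.\<close>

lemma covers_down_iff:
  assumes "w \<in> carrier P"
  shows "covers (down_poset P w) y x \<longleftrightarrow> covers P y x \<and> y \<sqsubseteq>\<^bsub>P\<^esub> w"
proof -
  have "z \<sqsubseteq>\<^bsub>P\<^esub> w" if "z \<sqsubset>\<^bsub>P\<^esub> y" "y \<sqsubseteq>\<^bsub>P\<^esub> w" "z \<in> carrier P" "y \<in> carrier P" for z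
    using that assms unfolding lless_def by (meson le_trans)
  then show ?thesis unfolding covers_def down_poset_simps mem_Collect_eq by blast
qed

lemma atoms_down: "w \<in> carrier P \<Longrightarrow> atoms (down_poset P w) = {a \<in> atoms P. a \<sqsubseteq>\<^bsub>P\<^esub> w}"
  by (auto simp: atoms_def covers_down_iff bottom_down)

text \<open>A common upper bound below the lattice join also lies below \<open>u\<close>. The
  lattice join is then below it in turn, which gives minimality in all of \<open>P\<close>.\<close>

lemma common_upper_bound_join:
  assumes "x \<in> carrier P" "y \<in> carrier P" "u \<in> carrier P" "x \<sqsubseteq>\<^bsub>P\<^esub> u" "y \<sqsubseteq>\<^bsub>P\<^esub> u"
  shows "x \<squnion>\<^bsub>down_poset P u\<^esub> y \<in> join_set P x y"
    and "x \<squnion>\<^bsub>down_poset P u\<^esub> y \<sqsubseteq>\<^bsub>P\<^esub> u"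
proof -
  interpret D: lattice "down_poset P u" using assms(3) by (rule down_lattice)
  let ?j = "x \<squnion>\<^bsub>down_poset P u\<^esub> y"
  have xy: "x \<in> carrier (down_poset P u)" "y \<in> carrier (down_poset P u)" using assms by auto
  have j: "?j \<in> carrier P" "?j \<sqsubseteq>\<^bsub>P\<^esub> u" using D.join_closed[OF xy] by auto
  have le: "x \<sqsubseteq>\<^bsub>P\<^esub> ?j" "y \<sqsubseteq>\<^bsub>P\<^esub> ?j" using D.join_left[OF xy] D.join_right[OF xy] by auto
  have "v = ?j" if v: "v \<in> carrier P" "x \<sqsubseteq>\<^bsub>P\<^esub> v" "y \<sqsubseteq>\<^bsub>P\<^esub> v" "v \<sqsubseteq>\<^bsub>P\<^esub> ?j" for v
  proof -
    have "v \<sqsubseteq>\<^bsub>P\<^esub> u" using v j assms(3) by (meson le_trans)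
    then have "?j \<sqsubseteq>\<^bsub>P\<^esub> v" using D.join_le[of x v y] xy v by simp
    then show ?thesis using v j by (intro le_antisym)
  qed
  then show "?j \<in> join_set P x y" "?j \<sqsubseteq>\<^bsub>P\<^esub> u"
    using j le assms(1,2) by (simp_all add: mem_join_set_iff)
qed

text \<open>Replaces the search for a minimal upper bound by that for any upper bound. Translativity
  and the double dagger condition are both used through this form.\<close>

lemma join_set_nonempty_iff:
  assumes "x \<in> carrier P" "y \<in> carrier P"
  shows "join_set P x y \<noteq> {} \<longleftrightarrow> (\<exists>u\<in>carrier P. x \<sqsubseteq>\<^bsub>P\<^esub> u \<and> y \<sqsubseteq>\<^bsub>P\<^esub> u)"
proof
  assume "join_set P x y \<noteq> {}"
  then show "\<exists>u\<in>carrier P. x \<sqsubseteq>\<^bsub>P\<^esub> u \<and> y \<sqsubseteq>\<^bsub>P\<^esub> u"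
    using mem_join_set_iff[OF assms] by blast
qed (use common_upper_bound_join(1) assms in blast)

lemma join_down_eq:
  assumes "x \<in> carrier P" "y \<in> carrier P" "w \<in> join_set P x y"
  shows "x \<squnion>\<^bsub>down_poset P w\<^esub> y = w"
  using assms common_upper_bound_join[of x y w] by (simp add: mem_join_set_iff)

text \<open>Below \<open>w\<close> the element \<open>w\<close> is itself the lattice join of
  \<open>x\<close> and \<open>a\<close>, so the geometric axiom applies there.\<close>

lemma covers_join_atom:
  assumes "x \<in> carrier P" "a \<in> atoms P" "\<not> a \<sqsubseteq>\<^bsub>P\<^esub> x" "w \<in> join_set P x a"
  shows "covers P w x"
proof -
  have a: "a \<in> carrier P" using assms(2) by (rule atom_carrier)
  have w: "w \<in> carrier P" "x \<sqsubseteq>\<^bsub>P\<^esub> w" "a \<sqsubseteq>\<^bsub>P\<^esub> w" using assms a by (auto simp: mem_join_set_iff)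
  have "covers (down_poset P w) w x"
    using down_geometric[OF w(1)] assms a w join_down_eq[OF assms(1) a assms(4)]
    by (auto simp: geometric_lattice_def atoms_down)
  then show ?thesis by (simp add: covers_down_iff w)
qed

lemma covers_imp_join_atom:
  assumes "covers P w x"
  obtains a where "a \<in> atoms P" "\<not> a \<sqsubseteq>\<^bsub>P\<^esub> x" "w \<in> join_set P x a"
proof -
  have x: "x \<in> carrier P" "w \<in> carrier P" "x \<sqsubseteq>\<^bsub>P\<^esub> w" using assms by (auto simp: covers_def lless_def)
  have "covers (down_poset P w) w x" using assms x by (simp add: covers_down_iff)
  then obtain a where a: "a \<in> atoms P" "a \<sqsubseteq>\<^bsub>P\<^esub> w" "\<not> a \<sqsubseteq>\<^bsub>P\<^esub> x" "w = x \<squnion>\<^bsub>down_poset P w\<^esub> a"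
    using down_geometric[OF x(2)] x by (auto simp: geometric_lattice_def atoms_down)
  then have "w \<in> join_set P x a"
    using common_upper_bound_join(1)[of x a w] x atom_carrier by simp
  with a that show thesis by blast
qed

section \<open>Maximal chains below an element, covers and rank\<close>

lemma maximal_chain_down_iff:
  "maximal_chain (down_poset P x) C \<longleftrightarrow> (\<forall>y\<in>C. y \<in> carrier P \<and> y \<sqsubseteq>\<^bsub>P\<^esub> x) \<and>
     (\<forall>y\<in>C. \<forall>z\<in>C. y \<sqsubseteq>\<^bsub>P\<^esub> z \<or> z \<sqsubseteq>\<^bsub>P\<^esub> y) \<and>
     (\<forall>z\<in>carrier P. z \<sqsubseteq>\<^bsub>P\<^esub> x \<longrightarrow> (\<forall>y\<in>C. y \<sqsubseteq>\<^bsub>P\<^esub> z \<or> z \<sqsubseteq>\<^bsub>P\<^esub> y) \<longrightarrow> z \<in> C)"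
  unfolding partial_order.maximal_chain_iff[OF down_partial_order] down_poset_simps subset_eq
    mem_Collect_eq Ball_def imp_conjL by simp

lemma finite_maximal_chain_down:
  "x \<in> carrier P \<Longrightarrow> maximal_chain (down_poset P x) C \<Longrightarrow> finite C"
  using locally_geometric unfolding locally_geometric_def graded_poset_def by blast

lemma top_mem_maximal_chain_down:
  "x \<in> carrier P \<Longrightarrow> maximal_chain (down_poset P x) C \<Longrightarrow> x \<in> C"
  by (simp add: maximal_chain_down_iff)

text \<open>Gradedness makes the description defining \<open>rk\<close> well posed. Every maximal
  chain contains \<open>x\<close>, so its cardinality is positive and has the predecessor that
  \<open>rk\<close> names.\<close>

lemma card_maximal_chain_down:
  assumes "x \<in> carrier P" "maximal_chain (down_poset P x) C"
  shows "card C = Suc (rk P x)"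
proof -
  have fin: "finite C" and "C \<noteq> {}"
    using assms finite_maximal_chain_down top_mem_maximal_chain_down by auto
  then obtain n where n: "card C = Suc n" by (metis card_gt_0_iff gr0_implies_Suc)
  have "card D = card C" if "maximal_chain (down_poset P x) D" for D
    using locally_geometric assms that unfolding locally_geometric_def graded_poset_def by blast
  then have "rk P x = n"
    unfolding rk_def using assms(2) n by (intro the_equality) auto
  then show ?thesis by (simp add: n)
qed

text \<open>Adding \<open>y\<close> on top of a maximal chain below \<open>x\<close> gives a maximal
  chain below \<open>y\<close>: an element comparable with the whole chain is either below
  \<open>x\<close>, or between \<open>x\<close> and \<open>y\<close> and hence one of them.\<close>

lemma rk_covers:
  assumes "covers P y x"
  shows "rk P y = Suc (rk P x)"
proof -
  have xy: "x \<in> carrier P" "y \<in> carrier P" "x \<sqsubseteq>\<^bsub>P\<^esub> y" "x \<noteq> y"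
    and between: "\<And>z. z \<in> carrier P \<Longrightarrow> x \<sqsubseteq>\<^bsub>P\<^esub> z \<Longrightarrow> z \<sqsubseteq>\<^bsub>P\<^esub> y \<Longrightarrow> z = x \<or> z = y"
    using assms by (auto simp: covers_def lless_def eq_is_equal)
  obtain C where C: "maximal_chain (down_poset P x) C" using maximal_chain_exists by blast
  have "x \<in> C" using top_mem_maximal_chain_down[OF xy(1) C] .
  have below: "\<forall>z\<in>C. z \<in> carrier P \<and> z \<sqsubseteq>\<^bsub>P\<^esub> x" using C by (simp add: maximal_chain_down_iff)
  then have below_y: "\<forall>z\<in>C. z \<sqsubseteq>\<^bsub>P\<^esub> y" using xy by (meson le_trans)
  have "y \<notin> C" using below xy by (meson le_antisym)
  have "z \<in> insert y C"
    if "z \<in> carrier P" "z \<sqsubseteq>\<^bsub>P\<^esub> y" "\<forall>c\<in>insert y C. c \<sqsubseteq>\<^bsub>P\<^esub> z \<or> z \<sqsubseteq>\<^bsub>P\<^esub> c" for z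
  proof (cases "z \<sqsubseteq>\<^bsub>P\<^esub> x")
    case True
    then show ?thesis using C that by (simp add: maximal_chain_down_iff)
  next
    case False
    then have "x \<sqsubseteq>\<^bsub>P\<^esub> z" using that \<open>x \<in> C\<close> by blast
    then show ?thesis using between that \<open>x \<in> C\<close> by blast
  qed
  then have max: "\<forall>z\<in>carrier P. z \<sqsubseteq>\<^bsub>P\<^esub> y \<longrightarrow>
      (\<forall>c\<in>insert y C. c \<sqsubseteq>\<^bsub>P\<^esub> z \<or> z \<sqsubseteq>\<^bsub>P\<^esub> c) \<longrightarrow> z \<in> insert y C"
    by (intro ballI impI)
  have sub: "\<forall>z\<in>insert y C. z \<in> carrier P \<and> z \<sqsubseteq>\<^bsub>P\<^esub> y" using below below_y xy by simp
  have total: "\<forall>z\<in>insert y C. \<forall>t\<in>insert y C. z \<sqsubseteq>\<^bsub>P\<^esub> t \<or> t \<sqsubseteq>\<^bsub>P\<^esub> z"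
    using C below_y xy(2) by (simp add: maximal_chain_down_iff)
  have "maximal_chain (down_poset P y) (insert y C)"
    unfolding maximal_chain_down_iff by (intro conjI sub total max)
  then have "card (insert y C) = Suc (rk P y)" using xy by (intro card_maximal_chain_down)
  moreover have "card C = Suc (rk P x)" "finite C"
    using xy C by (auto intro: card_maximal_chain_down finite_maximal_chain_down)
  ultimately show ?thesis using \<open>y \<notin> C\<close> by simp
qed

text \<open>The lower cover is the predecessor of \<open>z\<close> in a finite maximal chain ending
  in \<open>z\<close>. An element strictly between the two would be comparable with the whole chain
  and so would belong to it.\<close>

lemma lower_cover_exists:
  assumes "z \<in> carrier P" "z \<noteq> \<bottom>\<^bsub>P\<^esub>"
  obtains y where "covers P z y"
proof -
  obtain C where C: "maximal_chain (down_poset P z) C" using maximal_chain_exists by blast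
  have CP: "\<And>y. y \<in> C \<Longrightarrow> y \<in> carrier P \<and> y \<sqsubseteq>\<^bsub>P\<^esub> z"
    and tot: "\<And>x y. x \<in> C \<Longrightarrow> y \<in> C \<Longrightarrow> x \<sqsubseteq>\<^bsub>P\<^esub> y \<or> y \<sqsubseteq>\<^bsub>P\<^esub> x"
    and max: "\<And>t. t \<in> carrier P \<Longrightarrow> t \<sqsubseteq>\<^bsub>P\<^esub> z \<Longrightarrow> \<forall>y\<in>C. y \<sqsubseteq>\<^bsub>P\<^esub> t \<or> t \<sqsubseteq>\<^bsub>P\<^esub> y \<Longrightarrow> t \<in> C"
    using C by (auto simp: maximal_chain_down_iff)
  have "finite (C - {z})" using finite_maximal_chain_down[OF assms(1) C] by simp
  moreover have "\<bottom>\<^bsub>P\<^esub> \<in> C - {z}"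
    \<comment> \<open>The bottom is comparable with everything, so maximality puts it into
      \<open>C\<close>; hence removing \<open>z\<close> leaves a nonempty set.\<close>
    using max[of "\<bottom>\<^bsub>P\<^esub>"] assms CP bottom_carrier bottom_le by simp
  moreover have "asymp_on (C - {z}) (lless P)"
    using CP unfolding asymp_on_def lless_def eq_is_equal by (meson DiffD1 le_antisym)
  moreover have "transp_on (C - {z}) (lless P)"
    using CP by (auto simp: transp_on_def intro: lless_trans)
  ultimately obtain m where m: "m \<in> C" "m \<noteq> z" "\<And>x. x \<in> C - {z} \<Longrightarrow> x \<noteq> m \<Longrightarrow> \<not> m \<sqsubset>\<^bsub>P\<^esub> x"
    using Finite_Set.bex_max_element[of "C - {z}" "lless P"] by blast
  have below_m: "c \<sqsubseteq>\<^bsub>P\<^esub> m" if "c \<in> C" "c \<noteq> z" for c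
    using m(3)[of c] tot[of c m] that m(1) by (auto simp: lless_def eq_is_equal)
  have "t = m \<or> t = z" if t: "t \<in> carrier P" "m \<sqsubseteq>\<^bsub>P\<^esub> t" "t \<sqsubseteq>\<^bsub>P\<^esub> z" for t
  proof (rule ccontr)
    assume n: "\<not> (t = m \<or> t = z)"
    have "\<forall>c\<in>C. c \<sqsubseteq>\<^bsub>P\<^esub> t \<or> t \<sqsubseteq>\<^bsub>P\<^esub> c" 
    proof
      fix c assume "c \<in> C"
      then show "c \<sqsubseteq>\<^bsub>P\<^esub> t \<or> t \<sqsubseteq>\<^bsub>P\<^esub> c"
        using below_m[of c] t CP[of c] CP[OF m(1)] le_trans[of c m t] by (cases "c = z") auto
    qed
    then have "t \<in> C" using max t by blast
    then show False using below_m[of t] n t CP[OF m(1)] le_antisym by blast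
  qed
  then have "covers P z m"
    using CP[OF m(1)] m(2) assms(1) by (auto simp: covers_def lless_def eq_is_equal)
  then show thesis by (rule that)
qed

text \<open>For a competitor \<open>v\<close> below \<open>w\<close>, the meet of \<open>q\<close>
  and \<open>v\<close> taken below \<open>w\<close> still bounds \<open>I\<close>. Minimality of
  \<open>q\<close> makes this meet \<open>q\<close>, so \<open>v\<close> bounds both
  \<open>q\<close> and \<open>a\<close>, and minimality of \<open>w\<close> finishes.\<close>

lemma min_upper_bound_insert:
  assumes "I \<subseteq> carrier P" "q \<in> min_upper_bounds P I" "a \<in> carrier P" "w \<in> join_set P q a"
  shows "w \<in> min_upper_bounds P (insert a I)"
proof -
  have q: "q \<in> carrier P" "\<forall>i\<in>I. i \<sqsubseteq>\<^bsub>P\<^esub> q"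
    "\<And>v. v \<in> carrier P \<Longrightarrow> \<forall>i\<in>I. i \<sqsubseteq>\<^bsub>P\<^esub> v \<Longrightarrow> v \<sqsubseteq>\<^bsub>P\<^esub> q \<Longrightarrow> v = q"
    using assms by (auto simp: mem_min_upper_bounds_iff)
  have w: "w \<in> carrier P" "q \<sqsubseteq>\<^bsub>P\<^esub> w" "a \<sqsubseteq>\<^bsub>P\<^esub> w"
    "\<And>v. v \<in> carrier P \<Longrightarrow> q \<sqsubseteq>\<^bsub>P\<^esub> v \<Longrightarrow> a \<sqsubseteq>\<^bsub>P\<^esub> v \<Longrightarrow> v \<sqsubseteq>\<^bsub>P\<^esub> w \<Longrightarrow> v = w"
    using assms q(1) by (auto simp: mem_join_set_iff)
  have Iw: "\<forall>i\<in>I. i \<sqsubseteq>\<^bsub>P\<^esub> w" using q w assms(1) by (meson le_trans subsetD)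
  have "v = w" if v: "v \<in> carrier P" "\<forall>i\<in>insert a I. i \<sqsubseteq>\<^bsub>P\<^esub> v" "v \<sqsubseteq>\<^bsub>P\<^esub> w" for v
  proof -
    interpret D: lattice "down_poset P w" using w(1) by (rule down_lattice)
    let ?m = "q \<sqinter>\<^bsub>down_poset P w\<^esub> v"
    have qv: "q \<in> carrier (down_poset P w)" "v \<in> carrier (down_poset P w)" using q w v by auto
    have m: "?m \<in> carrier P" "?m \<sqsubseteq>\<^bsub>P\<^esub> q" "?m \<sqsubseteq>\<^bsub>P\<^esub> v"
      using D.meet_closed[OF qv] D.meet_left[OF qv] D.meet_right[OF qv] by auto
    have "i \<sqsubseteq>\<^bsub>P\<^esub> ?m" if "i \<in> I" for i
      using D.meet_le[of i q v] qv that q v Iw assms(1) by auto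
    then have "?m = q" using q(3) m by blast
    then have "q \<sqsubseteq>\<^bsub>P\<^esub> v" using m by simp
    then show ?thesis using w(4) v by simp
  qed
  then show ?thesis using assms Iw w by (subst mem_min_upper_bounds_iff) auto
qed

text \<open>Size and rank both grow by one: \<open>I\<close> lies below \<open>q\<close> and
  \<open>a\<close> does not, so \<open>a\<close> is new, and \<open>w\<close> covers
  \<open>q\<close>.\<close>

lemma atom_basis_insert:
  assumes "I \<subseteq> atoms P" "finite I" "card I = rk P q" "q \<in> min_upper_bounds P I"
    and "a \<in> atoms P" "\<not> a \<sqsubseteq>\<^bsub>P\<^esub> q" "w \<in> join_set P q a"
  shows "card (insert a I) = rk P w" and "w \<in> min_upper_bounds P (insert a I)"
proof -
  have I: "I \<subseteq> carrier P" and a: "a \<in> carrier P" using assms(1,5) atom_carrier by auto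
  have q: "q \<in> carrier P" "\<forall>i\<in>I. i \<sqsubseteq>\<^bsub>P\<^esub> q" using assms(4) I by (auto simp: mem_min_upper_bounds_iff)
  then have "a \<notin> I" using assms(6) by blast
  then show "card (insert a I) = rk P w"
    using rk_covers[OF covers_join_atom] assms q by simp
  show "w \<in> min_upper_bounds P (insert a I)"
    using min_upper_bound_insert I assms(4) a assms(7) .
qed

lemma rk_bottom: "rk P \<bottom>\<^bsub>P\<^esub> = 0"
proof -
  have "maximal_chain (down_poset P \<bottom>\<^bsub>P\<^esub>) {\<bottom>\<^bsub>P\<^esub>}"
    using bottom_carrier le_bottom_iff by (simp add: maximal_chain_down_iff)
  then show ?thesis using card_maximal_chain_down[OF bottom_carrier] by fastforce
qed

lemma atom_basis_exists:
  assumes "z \<in> carrier P"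
  shows "\<exists>I\<subseteq>atoms P. finite I \<and> card I = rk P z \<and> z \<in> min_upper_bounds P I"
  using assms
proof (induction "rk P z" arbitrary: z rule: less_induct)
  case less
  show ?case
  proof (cases "z = \<bottom>\<^bsub>P\<^esub>")
    case True
    \<comment> \<open>Every element bounds the empty set, so its minimal upper bound is the bottom,
      which has rank 0.\<close>
    then have "z \<in> min_upper_bounds P {}"
      using True bottom_carrier le_bottom_iff by (simp add: mem_min_upper_bounds_iff)
    then show ?thesis using True rk_bottom by (intro exI[of _ "{}"]) simp
  next
    case False
    then obtain y where y: "covers P z y" using lower_cover_exists less.prems by blast
    then have "y \<in> carrier P" by (simp add: covers_def)
    then obtain I where I: "I \<subseteq> atoms P" "finite I" "card I = rk P y" "y \<in> min_upper_bounds P I"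
      using less.hyps[of y] rk_covers[OF y] by auto
    obtain a where a: "a \<in> atoms P" "\<not> a \<sqsubseteq>\<^bsub>P\<^esub> y" "z \<in> join_set P y a"
      using covers_imp_join_atom[OF y] .
    show ?thesis
      using atom_basis_insert[OF I a] I a by (intro exI[of _ "insert a I"]) auto
  qed
qed

end


section \<open>Quotients by translative actions\<close>

lemma mem_orbit_iff: "y \<in> orbit G \<phi> x \<longleftrightarrow> (\<exists>g\<in>carrier G. y = \<phi> g x)"
  by (auto simp: orbit_def)

locale translative_quotient = locally_geometric_poset P
  for P :: "('a, 'm) gorder_scheme" +
  fixes G :: "('g, 'n) monoid_scheme" and \<phi> :: "'g \<Rightarrow> 'a \<Rightarrow> 'a"
  assumes translative: "translative_action G P \<phi>"

sublocale translative_quotient \<subseteq> group_action G "carrier P" \<phi>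
  using translative by (simp add: translative_action_def poset_action_def)

sublocale translative_quotient \<subseteq> G: group G
  using group_hom by (simp add: group_hom_def)

context translative_quotient
begin

abbreviation orb :: "'a \<Rightarrow> 'a set" where "orb \<equiv> orbit G \<phi>"

abbreviation R :: "'a set gorder" where "R \<equiv> quotient_poset G P \<phi>"

lemma act_closed: "g \<in> carrier G \<Longrightarrow> x \<in> carrier P \<Longrightarrow> \<phi> g x \<in> carrier P"
  by (rule element_image) simp_all

lemma act_le_iff:
  "g \<in> carrier G \<Longrightarrow> x \<in> carrier P \<Longrightarrow> y \<in> carrier P \<Longrightarrow> \<phi> g x \<sqsubseteq>\<^bsub>P\<^esub> \<phi> g y \<longleftrightarrow> x \<sqsubseteq>\<^bsub>P\<^esub> y"
  using translative by (simp add: translative_action_def poset_action_def order_emb_def)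

lemma act_inv: "g \<in> carrier G \<Longrightarrow> x \<in> carrier P \<Longrightarrow> \<phi> (inv\<^bsub>G\<^esub> g) (\<phi> g x) = x"
  by (rule orbit_sym_aux) simp_all

lemma act_one: "x \<in> carrier P \<Longrightarrow> \<phi> \<one>\<^bsub>G\<^esub> x = x"
  by (simp flip: id_eq_one)

text \<open>The working form of translativity: any common upper bound will do, minimal or
  not.\<close>

lemma act_eq_if_common_upper_bound:
  assumes "g \<in> carrier G" "x \<in> carrier P" "u \<in> carrier P" "x \<sqsubseteq>\<^bsub>P\<^esub> u" "\<phi> g x \<sqsubseteq>\<^bsub>P\<^esub> u"
  shows "\<phi> g x = x"
proof -
  have "join_set P x (\<phi> g x) \<noteq> {}"
    using assms act_closed by (subst join_set_nonempty_iff) auto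
  then show ?thesis
    using translative assms unfolding translative_action_def by metis
qed

lemma act_le_act_iff:
  assumes "g \<in> carrier G" "h \<in> carrier G" "x \<in> carrier P" "y \<in> carrier P"
  shows "\<phi> g x \<sqsubseteq>\<^bsub>P\<^esub> \<phi> h y \<longleftrightarrow> \<phi> (inv\<^bsub>G\<^esub> h \<otimes>\<^bsub>G\<^esub> g) x \<sqsubseteq>\<^bsub>P\<^esub> y"
proof -
  have "\<phi> (inv\<^bsub>G\<^esub> h) (\<phi> g x) \<sqsubseteq>\<^bsub>P\<^esub> \<phi> (inv\<^bsub>G\<^esub> h) (\<phi> h y) \<longleftrightarrow> \<phi> g x \<sqsubseteq>\<^bsub>P\<^esub> \<phi> h y"
    using assms act_closed by (intro act_le_iff) auto
  then show ?thesis using assms by (simp add: act_inv composition_rule)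
qed

lemma orb_act:
  assumes "g \<in> carrier G" "x \<in> carrier P"
  shows "orb (\<phi> g x) = orb x"
proof -
  have sub: "orb (\<phi> h y) \<subseteq> orb y" if "h \<in> carrier G" "y \<in> carrier P" for h y
    using that composition_rule[OF that(2) _ that(1), symmetric] by (auto simp: orbit_def)
  \<comment> \<open>The reverse inclusion is the same inclusion applied to the inverse of
    \<open>g\<close> at the translate of \<open>x\<close>.\<close>
  have "orb (\<phi> (inv\<^bsub>G\<^esub> g) (\<phi> g x)) \<subseteq> orb (\<phi> g x)"
    using assms act_closed by (intro sub) auto
  then show ?thesis using sub assms by (simp add: act_inv subset_antisym)
qed

lemma orb_eq_iff:
  assumes "x \<in> carrier P" "y \<in> carrier P"
  shows "orb x = orb y \<longleftrightarrow> (\<exists>g\<in>carrier G. y = \<phi> g x)"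
proof
  assume eq: "orb x = orb y"
  have "y \<in> orb y" unfolding mem_orbit_iff using act_one[OF assms(2)] G.one_closed by metis
  then show "\<exists>g\<in>carrier G. y = \<phi> g x" by (simp add: mem_orbit_iff eq[symmetric])
qed (metis assms(1) orb_act)

lemma carrier_R: "carrier R = orb ` carrier P"
  by (auto simp: quotient_poset_def orbits_def)

text \<open>The quotient order quantifies over representatives of both orbits and a group element.
  All three choices combine into one group element acting on the smaller side.\<close>

lemma R_le_iff:
  assumes "x \<in> carrier P" "y \<in> carrier P"
  shows "orb x \<sqsubseteq>\<^bsub>R\<^esub> orb y \<longleftrightarrow> (\<exists>g\<in>carrier G. \<phi> g x \<sqsubseteq>\<^bsub>P\<^esub> y)"
proof
  assume "orb x \<sqsubseteq>\<^bsub>R\<^esub> orb y"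
  then obtain x' y' g where *: "x' \<in> carrier P" "y' \<in> carrier P" "orb x = orb x'" "orb y = orb y'"
    "g \<in> carrier G" "x' \<sqsubseteq>\<^bsub>P\<^esub> \<phi> g y'"
    by (auto simp: quotient_poset_def)
  obtain h k where hk: "h \<in> carrier G" "k \<in> carrier G" "x' = \<phi> h x" "y' = \<phi> k y"
    using * assms by (metis orb_eq_iff)
  then have "\<phi> h x \<sqsubseteq>\<^bsub>P\<^esub> \<phi> (g \<otimes>\<^bsub>G\<^esub> k) y" using * assms by (simp add: composition_rule)
  then have "\<phi> (inv\<^bsub>G\<^esub> (g \<otimes>\<^bsub>G\<^esub> k) \<otimes>\<^bsub>G\<^esub> h) x \<sqsubseteq>\<^bsub>P\<^esub> y"
    using act_le_act_iff[of h "g \<otimes>\<^bsub>G\<^esub> k" x y] * hk assms by simp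
  then show "\<exists>g\<in>carrier G. \<phi> g x \<sqsubseteq>\<^bsub>P\<^esub> y" using * hk by (metis G.inv_closed G.m_closed)
next
  assume "\<exists>g\<in>carrier G. \<phi> g x \<sqsubseteq>\<^bsub>P\<^esub> y"
  then obtain g where g: "g \<in> carrier G" "\<phi> g x \<sqsubseteq>\<^bsub>P\<^esub> y" by blast
  then have "orb x = orb (\<phi> g x)" "\<phi> g x \<in> carrier P" "\<phi> g x \<sqsubseteq>\<^bsub>P\<^esub> \<phi> \<one>\<^bsub>G\<^esub> y"
    using assms by (simp_all add: orb_act act_closed act_one)
  then show "orb x \<sqsubseteq>\<^bsub>R\<^esub> orb y"
    unfolding quotient_poset_def using assms(2) G.one_closed by auto
qed

lemma R_le_if_le:
  assumes "x \<in> carrier P" "y \<in> carrier P" "x \<sqsubseteq>\<^bsub>P\<^esub> y"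
  shows "orb x \<sqsubseteq>\<^bsub>R\<^esub> orb y"
  using assms act_one[OF assms(1)] G.one_closed R_le_iff[OF assms(1,2)] by metis

text \<open>Orbits below that of \<open>u\<close> lift to elements below \<open>u\<close> itself,
  which makes the quotient map surjective between the intervals.\<close>

lemma R_le_representative:
  assumes "X \<in> carrier R" "u \<in> carrier P" "X \<sqsubseteq>\<^bsub>R\<^esub> orb u"
  obtains x where "x \<in> carrier P" "x \<sqsubseteq>\<^bsub>P\<^esub> u" "X = orb x"
proof -
  obtain y where y: "y \<in> carrier P" "X = orb y" using assms(1) by (auto simp: carrier_R)
  then obtain g where "g \<in> carrier G" "\<phi> g y \<sqsubseteq>\<^bsub>P\<^esub> u" using assms by (auto simp: R_le_iff)
  with y that[of "\<phi> g y"] show thesis by (simp add: act_closed orb_act)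
qed

text \<open>If \<open>g x \<le> y\<close> and both \<open>x, y\<close> lie below \<open>u\<close>, then \<open>u\<close> bounds \<open>x\<close> and \<open>g x\<close>, so translativity
  gives \<open>g x = x\<close>: below a single element the quotient map reflects the order.\<close>

lemma R_le_iff_below:
  assumes "u \<in> carrier P" "x \<in> carrier P" "y \<in> carrier P" "x \<sqsubseteq>\<^bsub>P\<^esub> u" "y \<sqsubseteq>\<^bsub>P\<^esub> u"
  shows "orb x \<sqsubseteq>\<^bsub>R\<^esub> orb y \<longleftrightarrow> x \<sqsubseteq>\<^bsub>P\<^esub> y"
proof
  assume "orb x \<sqsubseteq>\<^bsub>R\<^esub> orb y"
  then obtain g where g: "g \<in> carrier G" "\<phi> g x \<sqsubseteq>\<^bsub>P\<^esub> y" using assms R_le_iff by blast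
  then have "\<phi> g x \<sqsubseteq>\<^bsub>P\<^esub> u" using assms act_closed le_trans[of "\<phi> g x" y u] by blast
  then show "x \<sqsubseteq>\<^bsub>P\<^esub> y" using act_eq_if_common_upper_bound[of g x u] g assms by simp
qed (use R_le_if_le assms in blast)

lemma orb_eq_iff_below:
  assumes "u \<in> carrier P" "x \<in> carrier P" "y \<in> carrier P" "x \<sqsubseteq>\<^bsub>P\<^esub> u" "y \<sqsubseteq>\<^bsub>P\<^esub> u"
  shows "orb x = orb y \<longleftrightarrow> x = y"
  using assms act_eq_if_common_upper_bound by (metis orb_eq_iff)

lemma partial_order_R: "partial_order R"
proof
  fix X Y Z assume X: "X \<in> carrier R" and Y: "Y \<in> carrier R" and Z: "Z \<in> carrier R"
  have eq: "X .=\<^bsub>R\<^esub> Y \<longleftrightarrow> X = Y" for X Y by (simp add: quotient_poset_def)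
  show "X \<sqsubseteq>\<^bsub>R\<^esub> X" using X R_le_if_le by (auto simp: carrier_R)
  show "X .=\<^bsub>R\<^esub> Y" if XY: "X \<sqsubseteq>\<^bsub>R\<^esub> Y" and YX: "Y \<sqsubseteq>\<^bsub>R\<^esub> X"
  proof -
    obtain x where x: "x \<in> carrier P" "X = orb x" using X by (auto simp: carrier_R)
    obtain y where y: "y \<in> carrier P" "y \<sqsubseteq>\<^bsub>P\<^esub> x" "Y = orb y"
      using R_le_representative[OF Y x(1)] YX x(2) by auto
    \<comment> \<open>With \<open>y\<close> chosen below \<open>x\<close>, both elements share the
      upper bound \<open>x\<close>, so the reverse inequality of orbits is reflected in
      \<open>P\<close>. Antisymmetry thus rests on translativity.\<close>
    have "x \<sqsubseteq>\<^bsub>P\<^esub> y" using R_le_iff_below[of x x y] x y XY by simp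
    then show ?thesis using x y le_antisym[of x y] by (simp add: eq)
  qed
  show "X \<sqsubseteq>\<^bsub>R\<^esub> Z" if XY: "X \<sqsubseteq>\<^bsub>R\<^esub> Y" and YZ: "Y \<sqsubseteq>\<^bsub>R\<^esub> Z"
  proof -
    obtain z where z: "z \<in> carrier P" "Z = orb z" using Z by (auto simp: carrier_R)
    obtain y where y: "y \<in> carrier P" "y \<sqsubseteq>\<^bsub>P\<^esub> z" "Y = orb y"
      using R_le_representative[OF Y z(1)] YZ z(2) by auto
    obtain x where x: "x \<in> carrier P" "x \<sqsubseteq>\<^bsub>P\<^esub> y" "X = orb x"
      using R_le_representative[OF X y(1)] XY y(3) by auto
    show ?thesis using x y z le_trans[of x y z] R_le_if_le by simp
  qed
qed (auto simp: quotient_poset_def)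

lemma order_iso_down:
  assumes "u \<in> carrier P"
  shows "order_iso (down_poset P u) (down_poset R (orb u)) orb"
proof -
  interpret D: partial_order "down_poset P u" by (rule down_partial_order)
  interpret E: partial_order "down_poset R (orb u)"
    using partial_order_R by (rule partial_order_down_poset)
  show ?thesis
  proof
    have "inj_on orb (carrier (down_poset P u))"
      using orb_eq_iff_below[OF assms] by (auto simp: inj_on_def)
    moreover have "X \<in> orb ` carrier (down_poset P u)" if "X \<in> carrier (down_poset R (orb u))" for X
      using R_le_representative[of X u] assms that by auto
    moreover have "orb x \<in> carrier (down_poset R (orb u))" if "x \<in> carrier (down_poset P u)" for x
      using that assms R_le_if_le by (auto simp: carrier_R)
    ultimately show "bij_betw orb (carrier (down_poset P u)) (carrier (down_poset R (orb u)))"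
      by (auto simp: bij_betw_def)
  qed (use R_le_iff_below[OF assms] in auto)
qed

lemma rk_orb: "u \<in> carrier P \<Longrightarrow> rk R (orb u) = rk P u"
  using rk_eq_if_order_iso[OF order_iso_down] by metis

lemma modular_element_orb_iff:
  assumes "u \<in> carrier P" "y \<in> carrier P" "y \<sqsubseteq>\<^bsub>P\<^esub> u"
  shows "modular_element (down_poset R (orb u)) (orb y) \<longleftrightarrow> modular_element (down_poset P u) y"
  using order_iso.modular_element_image_iff[OF order_iso_down[OF assms(1)]
      down_lattice[OF assms(1)] down_least[OF assms(1)] down_greatest[OF assms(1)], of y] assms
  by simp

text \<open>Requiring \<open>T\<close> to lie below \<open>u\<close> fixes compatible
  representatives: competing bounds below the orbit of \<open>u\<close> also lift below
  \<open>u\<close>, where the quotient map reflects the order.\<close>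

lemma min_upper_bounds_orb_iff:
  assumes "T \<subseteq> carrier P" "u \<in> carrier P" "\<And>t. t \<in> T \<Longrightarrow> t \<sqsubseteq>\<^bsub>P\<^esub> u"
  shows "orb u \<in> min_upper_bounds R (orb ` T) \<longleftrightarrow> u \<in> min_upper_bounds P T"
proof -
  have T: "orb ` T \<subseteq> carrier R" using assms(1) by (auto simp: carrier_R)
  have bound: "\<forall>X\<in>orb ` T. X \<sqsubseteq>\<^bsub>R\<^esub> orb u" "orb u \<in> carrier R"
    using assms R_le_if_le by (auto simp: carrier_R)
  have bound_iff: "(\<forall>X\<in>orb ` T. X \<sqsubseteq>\<^bsub>R\<^esub> orb v) \<longleftrightarrow> (\<forall>t\<in>T. t \<sqsubseteq>\<^bsub>P\<^esub> v)"
    if "v \<in> carrier P" "v \<sqsubseteq>\<^bsub>P\<^esub> u" for v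
    using R_le_iff_below[OF assms(2)] assms that by (auto simp: subset_iff)
  have "(\<forall>V\<in>carrier R. (\<forall>X\<in>orb ` T. X \<sqsubseteq>\<^bsub>R\<^esub> V) \<longrightarrow> V \<sqsubseteq>\<^bsub>R\<^esub> orb u \<longrightarrow> V = orb u) \<longleftrightarrow>
      (\<forall>v\<in>carrier P. (\<forall>t\<in>T. t \<sqsubseteq>\<^bsub>P\<^esub> v) \<longrightarrow> v \<sqsubseteq>\<^bsub>P\<^esub> u \<longrightarrow> v = u)" (is "?l \<longleftrightarrow> ?r")
  proof
    assume l: ?l
    show ?r
    proof (intro ballI impI)
      fix v assume v: "v \<in> carrier P" "\<forall>t\<in>T. t \<sqsubseteq>\<^bsub>P\<^esub> v" "v \<sqsubseteq>\<^bsub>P\<^esub> u"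
      then have "orb v = orb u"
        using l bound_iff[of v] R_le_if_le[of v u] assms(2) by (simp add: carrier_R)
      then show "v = u" using orb_eq_iff_below[of u v u] v assms(2) by simp
    qed
  next
    assume r: ?r
    show ?l
    proof (intro ballI impI)
      fix V assume V: "V \<in> carrier R" "\<forall>X\<in>orb ` T. X \<sqsubseteq>\<^bsub>R\<^esub> V" "V \<sqsubseteq>\<^bsub>R\<^esub> orb u"
      obtain v where v: "v \<in> carrier P" "v \<sqsubseteq>\<^bsub>P\<^esub> u" "V = orb v"
        using R_le_representative[OF V(1) assms(2) V(3)] .
      then have "v = u" using r bound_iff[of v] V(2) by blast
      then show "V = orb u" using v(3) by simp
    qed
  qed
  then show ?thesis
    using assms bound by (simp add: mem_min_upper_bounds_iff[OF T] mem_min_upper_bounds_iff)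
qed

text \<open>A common upper bound of the orbits bounds translates of both \<open>x\<close> and
  \<open>y\<close>. One further translation returns the second to \<open>y\<close>, leaving a single
  group element on \<open>x\<close>; this element is the obstruction in (M1).\<close>

lemma join_set_R_nonempty_iff:
  assumes "x \<in> carrier P" "y \<in> carrier P"
  shows "join_set R (orb x) (orb y) \<noteq> {} \<longleftrightarrow> (\<exists>g\<in>carrier G. join_set P (\<phi> g x) y \<noteq> {})"
proof
  assume "join_set R (orb x) (orb y) \<noteq> {}"
  then obtain U where U: "U \<in> carrier R" "orb x \<sqsubseteq>\<^bsub>R\<^esub> U" "orb y \<sqsubseteq>\<^bsub>R\<^esub> U"
    using assms by (auto simp: ex_in_conv[symmetric] mem_join_set_iff carrier_R)
  then obtain v where v: "v \<in> carrier P" "U = orb v" by (auto simp: carrier_R)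
  obtain g h where gh: "g \<in> carrier G" "h \<in> carrier G" "\<phi> g x \<sqsubseteq>\<^bsub>P\<^esub> v" "\<phi> h y \<sqsubseteq>\<^bsub>P\<^esub> v"
    using U v assms by (auto simp: R_le_iff)
  let ?k = "inv\<^bsub>G\<^esub> h"
  have "\<phi> ?k (\<phi> g x) \<sqsubseteq>\<^bsub>P\<^esub> \<phi> ?k v" "\<phi> ?k (\<phi> h y) \<sqsubseteq>\<^bsub>P\<^esub> \<phi> ?k v"
    using gh v assms by (simp_all add: act_le_iff act_closed)
  then have "\<phi> (?k \<otimes>\<^bsub>G\<^esub> g) x \<sqsubseteq>\<^bsub>P\<^esub> \<phi> ?k v" "y \<sqsubseteq>\<^bsub>P\<^esub> \<phi> ?k v"
    using gh assms by (simp_all add: composition_rule act_inv)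
  then have "join_set P (\<phi> (?k \<otimes>\<^bsub>G\<^esub> g) x) y \<noteq> {}"
    using gh v assms act_closed by (subst join_set_nonempty_iff) auto
  then show "\<exists>g\<in>carrier G. join_set P (\<phi> g x) y \<noteq> {}"
    using gh by (metis G.inv_closed G.m_closed)
next
  assume "\<exists>g\<in>carrier G. join_set P (\<phi> g x) y \<noteq> {}"
  then obtain g u where g: "g \<in> carrier G" and u: "u \<in> join_set P (\<phi> g x) y" by blast
  have gx: "\<phi> g x \<in> carrier P" using g assms(1) by (rule act_closed)
  have "orb u \<in> min_upper_bounds R (orb ` {\<phi> g x, y})"
    using u gx assms(2) by (subst min_upper_bounds_orb_iff) (auto simp: mem_join_set_iff join_set_def[symmetric])
  then show "join_set R (orb x) (orb y) \<noteq> {}"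
    using g assms(1) by (auto simp: join_set_def orb_act)
qed

section \<open>Bottom and atoms of the quotient\<close>

lemma R_bottom: "\<bottom>\<^bsub>R\<^esub> = orb \<bottom>\<^bsub>P\<^esub>"
proof -
  interpret R: partial_order R by (rule partial_order_R)
  have "least R (orb \<bottom>\<^bsub>P\<^esub>) (carrier R)"
    using bottom_carrier bottom_le R_le_if_le by (auto simp: least_def carrier_R)
  then show ?thesis unfolding bottom_def[of R] by (metis R.least_unique someI_ex)
qed

text \<open>Whether \<open>a\<close> covers the bottom is decided among elements below
  \<open>a\<close>, where the quotient map preserves and reflects strict order.\<close>

lemma atoms_R: "atoms R = orb ` atoms P"
proof -
  interpret R: partial_order R by (rule partial_order_R)
  have lless_iff: "orb x \<sqsubset>\<^bsub>R\<^esub> orb y \<longleftrightarrow> x \<sqsubset>\<^bsub>P\<^esub> y"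
    if "x \<in> carrier P" "y \<in> carrier P" "u \<in> carrier P" "x \<sqsubseteq>\<^bsub>P\<^esub> u" "y \<sqsubseteq>\<^bsub>P\<^esub> u" for x y u
    using that R_le_iff_below[of u x y] orb_eq_iff_below[of u x y]
    by (simp add: lless_def R.eq_is_equal eq_is_equal)
  have "covers R (orb a) (orb \<bottom>\<^bsub>P\<^esub>) \<longleftrightarrow> covers P a \<bottom>\<^bsub>P\<^esub>" if a: "a \<in> carrier P" for a
  proof -
    have "(\<exists>Z\<in>carrier R. orb \<bottom>\<^bsub>P\<^esub> \<sqsubset>\<^bsub>R\<^esub> Z \<and> Z \<sqsubset>\<^bsub>R\<^esub> orb a) \<longleftrightarrow>
        (\<exists>z\<in>carrier P. \<bottom>\<^bsub>P\<^esub> \<sqsubset>\<^bsub>P\<^esub> z \<and> z \<sqsubset>\<^bsub>P\<^esub> a)" (is "?l \<longleftrightarrow> ?r")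
    proof
      assume ?l
      then obtain Z where Z: "Z \<in> carrier R" "orb \<bottom>\<^bsub>P\<^esub> \<sqsubset>\<^bsub>R\<^esub> Z" "Z \<sqsubset>\<^bsub>R\<^esub> orb a" by blast
      then have "Z \<sqsubseteq>\<^bsub>R\<^esub> orb a" by (simp add: lless_def)
      from R_le_representative[OF Z(1) a this]
      obtain z where z: "z \<in> carrier P" "z \<sqsubseteq>\<^bsub>P\<^esub> a" "Z = orb z" .
      then show ?r
        using Z a lless_iff[of "\<bottom>\<^bsub>P\<^esub>" z a] lless_iff[of z a a] bottom_carrier bottom_le by auto
    next
      assume ?r
      then obtain z where z: "z \<in> carrier P" "\<bottom>\<^bsub>P\<^esub> \<sqsubset>\<^bsub>P\<^esub> z" "z \<sqsubset>\<^bsub>P\<^esub> a" by blast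
      then have "z \<sqsubseteq>\<^bsub>P\<^esub> a" by (simp add: lless_def)
      then have "orb \<bottom>\<^bsub>P\<^esub> \<sqsubset>\<^bsub>R\<^esub> orb z" "orb z \<sqsubset>\<^bsub>R\<^esub> orb a"
        using z a lless_iff[of "\<bottom>\<^bsub>P\<^esub>" z a] lless_iff[of z a a] bottom_carrier bottom_le by auto
      then show ?l using z(1) by (auto simp: carrier_R)
    qed
    then show ?thesis
      using a lless_iff[of "\<bottom>\<^bsub>P\<^esub>" a a] bottom_carrier bottom_le unfolding covers_def
      by (simp add: carrier_R)
  qed
  then show ?thesis by (auto simp: atoms_def carrier_R R_bottom)
qed

end

locale invariant_subset = translative_quotient P G \<phi>
  for P :: "('a, 'm) gorder_scheme" and G :: "('g, 'n) monoid_scheme"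
    and \<phi> :: "'g \<Rightarrow> 'a \<Rightarrow> 'a" +
  fixes Q :: "'a set"
  assumes Q_carrier: "Q \<subseteq> carrier P"
    and Q_invariant: "(\<Union>g\<in>carrier G. \<phi> g ` Q) = Q"
begin

abbreviation QR :: "'a set set" where "QR \<equiv> orbits G Q \<phi>"

lemma QR_eq: "QR = orb ` Q"
  by (auto simp: orbits_def)

text \<open>Invariance makes \<open>Q\<close> a union of orbits, so membership can be tested on any
  representative.\<close>

lemma orb_mem_QR_iff:
  assumes "x \<in> carrier P"
  shows "orb x \<in> QR \<longleftrightarrow> x \<in> Q"
proof
  assume "orb x \<in> QR"
  then obtain y where y: "y \<in> Q" "orb y = orb x" by (auto simp: QR_eq)
  then obtain g where "g \<in> carrier G" "x = \<phi> g y"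
    using orb_eq_iff[of y x] assms Q_carrier by blast
  then show "x \<in> Q" using y(1) Q_invariant by blast
qed (simp add: QR_eq)

lemma order_ideal_orbits_iff: "order_ideal R QR \<longleftrightarrow> order_ideal P Q"
proof
  assume l: "order_ideal R QR"
  have "x \<in> Q" if "y \<in> Q" "x \<in> carrier P" "x \<sqsubseteq>\<^bsub>P\<^esub> y" for x y
  proof -
    have "orb x \<sqsubseteq>\<^bsub>R\<^esub> orb y" using that Q_carrier R_le_if_le by blast
    moreover have "orb y \<in> QR" "orb x \<in> carrier R" using that by (auto simp: QR_eq carrier_R)
    ultimately have "orb x \<in> QR" using l unfolding order_ideal_def by blast
    then show ?thesis using that orb_mem_QR_iff by simp
  qed
  then show "order_ideal P Q" using Q_carrier by (auto simp: order_ideal_def)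
next
  assume r: "order_ideal P Q"
  have "X \<in> QR" if Y: "Y \<in> QR" and X: "X \<in> carrier R" "X \<sqsubseteq>\<^bsub>R\<^esub> Y" for X Y
  proof -
    obtain y where y: "y \<in> Q" "Y = orb y" "y \<in> carrier P" using Y Q_carrier by (auto simp: QR_eq)
    obtain x where x: "x \<in> carrier P" "x \<sqsubseteq>\<^bsub>P\<^esub> y" "X = orb x"
      using R_le_representative[OF X(1) y(3)] X(2) y(2) by auto
    then have "x \<in> Q" using r y unfolding order_ideal_def by blast
    then show ?thesis using x by (simp add: QR_eq)
  qed
  then show "order_ideal R QR" using Q_carrier by (auto simp: order_ideal_def QR_eq carrier_R)
qed

lemma maximal_elements_orbits: "maximal_elements R QR = orb ` maximal_elements P Q"
proof -
  have "(\<forall>Y\<in>QR. orb x \<sqsubseteq>\<^bsub>R\<^esub> Y \<longrightarrow> Y = orb x) \<longleftrightarrow> (\<forall>y\<in>Q. x \<sqsubseteq>\<^bsub>P\<^esub> y \<longrightarrow> y = x)" (is "?l \<longleftrightarrow> ?r")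
    if x: "x \<in> Q" for x
  proof
    assume l: ?l
    show ?r
    proof (intro ballI impI)
      fix y assume y: "y \<in> Q" "x \<sqsubseteq>\<^bsub>P\<^esub> y"
      have xy: "x \<in> carrier P" "y \<in> carrier P" using x y Q_carrier by auto
      have "orb y = orb x" using l y R_le_if_le[OF xy] by (simp add: QR_eq)
      then show "y = x" using orb_eq_iff_below[of y y x] xy y by simp
    qed
  next
    assume r: ?r
    show ?l
    proof (intro ballI impI)
      fix Y assume Y: "Y \<in> QR" "orb x \<sqsubseteq>\<^bsub>R\<^esub> Y"
      obtain y where y: "y \<in> Q" "Y = orb y" using Y by (auto simp: QR_eq)
      have xy: "x \<in> carrier P" "y \<in> carrier P" using x y Q_carrier by auto
      obtain g where g: "g \<in> carrier G" "\<phi> g x \<sqsubseteq>\<^bsub>P\<^esub> y" using Y y xy R_le_iff by auto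
      \<comment> \<open>An orbit above that of \<open>x\<close> has a representative above
        \<open>x\<close> itself, and invariance keeps this representative in
        \<open>Q\<close>.\<close>
      let ?z = "\<phi> (inv\<^bsub>G\<^esub> g) y"
      have "\<phi> (inv\<^bsub>G\<^esub> g) (\<phi> g x) \<sqsubseteq>\<^bsub>P\<^esub> ?z"
        using g xy by (simp add: act_le_iff act_closed)
      then have "x \<sqsubseteq>\<^bsub>P\<^esub> ?z" using g xy by (simp add: act_inv)
      moreover have "?z \<in> Q" using y(1) g(1) Q_invariant G.inv_closed by blast
      ultimately have "?z = x" using r by blast
      then show "Y = orb x" using orb_act[of "inv\<^bsub>G\<^esub> g" y] g xy y by simp
    qed
  qed
  then show ?thesis by (auto simp: maximal_elements_def QR_eq)
qed

lemma pure_ideal_orbits_iff: "pure_ideal R QR \<longleftrightarrow> pure_ideal P Q"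
proof -
  have "rk R (orb x) = rk P x" if "x \<in> maximal_elements P Q" for x
    using that Q_carrier rk_orb by (auto simp: maximal_elements_def)
  then show ?thesis by (simp add: pure_ideal_def maximal_elements_orbits)
qed

lemma join_closed_orbits_iff: "Defs.join_closed R QR \<longleftrightarrow> Defs.join_closed P Q"
proof
  assume l: "Defs.join_closed R QR"
  have "u \<in> Q" if T: "T \<subseteq> Q" and u: "u \<in> min_upper_bounds P T" for T u
  proof -
    have TP: "T \<subseteq> carrier P" using T Q_carrier by blast
    then have uP: "u \<in> carrier P" "\<And>t. t \<in> T \<Longrightarrow> t \<sqsubseteq>\<^bsub>P\<^esub> u"
      using u by (auto simp: mem_min_upper_bounds_iff)
    have "orb u \<in> min_upper_bounds R (orb ` T)"
      using min_upper_bounds_orb_iff[OF TP uP] u by simp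
    moreover have "orb ` T \<subseteq> QR" using T by (auto simp: QR_eq)
    ultimately have "orb u \<in> QR" using l unfolding Defs.join_closed_def by blast
    then show ?thesis using uP orb_mem_QR_iff by simp
  qed
  then show "Defs.join_closed P Q" by (auto simp: Defs.join_closed_def)
next
  assume r: "Defs.join_closed P Q"
  have "U \<in> QR" if S: "S \<subseteq> QR" and U: "U \<in> min_upper_bounds R S" for S U
  proof -
    have SR: "S \<subseteq> carrier R" using S Q_carrier unfolding QR_eq carrier_R by blast
    then have UR: "U \<in> carrier R" "\<forall>X\<in>S. X \<sqsubseteq>\<^bsub>R\<^esub> U" using U by (auto simp: mem_min_upper_bounds_iff)
    obtain u where u: "u \<in> carrier P" "U = orb u" using UR by (auto simp: carrier_R)
    \<comment> \<open>Lifts \<open>S\<close> to representatives below \<open>u\<close>, the position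
      that \<open>min_upper_bounds_orb_iff\<close> demands.\<close>
    define T where "T = {t \<in> carrier P. t \<sqsubseteq>\<^bsub>P\<^esub> u \<and> orb t \<in> S}"
    have "X \<in> orb ` T" if "X \<in> S" for X
    proof -
      have "X \<in> carrier R" "X \<sqsubseteq>\<^bsub>R\<^esub> orb u" using that SR UR u by auto
      then obtain t where "t \<in> carrier P" "t \<sqsubseteq>\<^bsub>P\<^esub> u" "X = orb t"
        using R_le_representative u(1) by blast
      then show ?thesis using that by (auto simp: T_def)
    qed
    then have "orb ` T = S" by (auto simp: T_def)
    moreover have "T \<subseteq> carrier P" "\<And>t. t \<in> T \<Longrightarrow> t \<sqsubseteq>\<^bsub>P\<^esub> u" by (simp_all add: T_def)
    ultimately have "u \<in> min_upper_bounds P T"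
      using min_upper_bounds_orb_iff[of T u] U u by simp
    moreover have "T \<subseteq> Q" unfolding T_def using S orb_mem_QR_iff by blast
    ultimately have "u \<in> Q" using r unfolding Defs.join_closed_def by blast
    then show ?thesis using u by (simp add: QR_eq)
  qed
  then show "Defs.join_closed R QR" by (auto simp: Defs.join_closed_def)
qed

text \<open>The whole carrier is itself an invariant subset, so the result for \<open>Q\<close>
  applies to it.\<close>

lemma maximal_elements_R: "maximal_elements R (carrier R) = orb ` maximal_elements P (carrier P)"
proof -
  have "(\<Union>g\<in>carrier G. \<phi> g ` carrier P) = carrier P"
    using surj_prop G.one_closed by auto
  then interpret all: invariant_subset P G \<phi> "carrier P" by unfold_locales auto
  show ?thesis using all.maximal_elements_orbits by (simp add: all.QR_eq carrier_R)
qed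

lemma modular_condition_orbits_iff:
  "(\<forall>X\<in>maximal_elements R (carrier R). \<exists>Y\<in>maximal_elements R QR. modular_element (down_poset R X) Y)
   \<longleftrightarrow> (\<forall>x\<in>maximal_elements P (carrier P). \<exists>y\<in>maximal_elements P Q. modular_element (down_poset P x) y)"
proof -
  have "(\<exists>Y\<in>maximal_elements R QR. modular_element (down_poset R (orb x)) Y) \<longleftrightarrow>
      (\<exists>y\<in>maximal_elements P Q. modular_element (down_poset P x) y)" (is "?l \<longleftrightarrow> ?r")
    if "x \<in> maximal_elements P (carrier P)" for x
  proof -
    have x: "x \<in> carrier P" using that by (simp add: maximal_elements_def)
    show ?thesis
    proof
      assume ?l
      then obtain Y where Y: "Y \<in> maximal_elements R QR" "modular_element (down_poset R (orb x)) Y"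
        by blast
      then have "Y \<in> carrier R" "Y \<sqsubseteq>\<^bsub>R\<^esub> orb x" by (auto simp: modular_element_def)
      then obtain y where y: "y \<in> carrier P" "y \<sqsubseteq>\<^bsub>P\<^esub> x" "Y = orb y"
        using R_le_representative x by blast
      \<comment> \<open>\<open>maximal_elements_orbits\<close> provides a maximal representative of
        \<open>Y\<close>, but perhaps not one below \<open>x\<close>. Maximality is therefore proved
        directly for the representative \<open>y\<close> below \<open>x\<close>, to which the
        modularity transfer applies.\<close>
      have "\<forall>t\<in>Q. y \<sqsubseteq>\<^bsub>P\<^esub> t \<longrightarrow> t = y"
      proof (intro ballI impI)
        fix t assume t: "t \<in> Q" "y \<sqsubseteq>\<^bsub>P\<^esub> t"
        have tP: "t \<in> carrier P" using t Q_carrier by blast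
        have "orb y \<sqsubseteq>\<^bsub>R\<^esub> orb t" using t tP y R_le_if_le by blast
        moreover have "orb t \<in> QR" using t by (simp add: QR_eq)
        ultimately have "orb t = orb y" using Y(1) y(3) by (auto simp: maximal_elements_def)
        then show "t = y" using orb_eq_iff_below[of t t y] t tP y by simp
      qed
      moreover have "y \<in> Q" using Y(1) y orb_mem_QR_iff by (auto simp: maximal_elements_def)
      ultimately have "y \<in> maximal_elements P Q" by (simp add: maximal_elements_def)
      then show ?r using modular_element_orb_iff[OF x y(1,2)] Y y by blast
    next
      assume ?r
      then obtain y where y: "y \<in> maximal_elements P Q" "modular_element (down_poset P x) y" by blast
      then have "y \<in> carrier P" "y \<sqsubseteq>\<^bsub>P\<^esub> x" by (auto simp: modular_element_def)
      then show ?l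
        using modular_element_orb_iff[OF x] y by (auto simp: maximal_elements_orbits)
    qed
  qed
  then show ?thesis by (simp add: maximal_elements_R)
qed

text \<open>An empty join of orbits excludes joins of \<open>y\<close> with every translate of
  \<open>a\<close>, in particular with \<open>a\<close> itself.\<close>

lemma atom_condition_orbits:
  assumes "\<forall>y\<in>Q. \<forall>a\<in>atoms P. join_set P a y = {} \<longrightarrow> a \<in> Q"
  shows "\<forall>Y\<in>QR. \<forall>A\<in>atoms R. join_set R A Y = {} \<longrightarrow> A \<in> QR"
proof (intro ballI impI)
  fix Y A assume Y: "Y \<in> QR" and A: "A \<in> atoms R" and empty: "join_set R A Y = {}"
  obtain y where y: "y \<in> Q" "Y = orb y" "y \<in> carrier P" using Y Q_carrier by (auto simp: QR_eq)
  obtain a where a: "a \<in> atoms P" "A = orb a" using A by (auto simp: atoms_R)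
  have "join_set P (\<phi> \<one>\<^bsub>G\<^esub> a) y = {}"
    using join_set_R_nonempty_iff[of a y] a y empty atom_carrier G.one_closed by auto
  then have "a \<in> Q" using assms a y act_one[of a] atom_carrier by auto
  then show "A \<in> QR" using a by (simp add: QR_eq)
qed

text \<open>Suppose \<open>a \<notin> Q\<close>, so that \<open>a\<close> has a join \<open>w\<close> with some translate \<open>q = g y\<close>. Adjoining \<open>a\<close> to a
  basis of \<open>q\<close> yields a basis of \<open>w\<close>, to which the double dagger condition applies relative to \<open>y\<close>.
  It cannot return an atom \<open>b \<le> q\<close>: a common upper bound of \<open>b\<close> and \<open>y\<close> also bounds \<open>g\<inverse> b \<le> y\<close>,
  which by translativity forces \<open>b = g\<inverse> b \<le> y\<close>.\<close>

lemma atom_condition_if_orbits: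
  assumes dagger: "double_dagger_condition P"
    and M1: "\<forall>Y\<in>QR. \<forall>A\<in>atoms R. join_set R A Y = {} \<longrightarrow> A \<in> QR"
    and ideal: "order_ideal P Q"
  shows "\<forall>y\<in>Q. \<forall>a\<in>atoms P. join_set P a y = {} \<longrightarrow> a \<in> Q"
proof (intro ballI impI, rule ccontr)
  fix y a assume yQ: "y \<in> Q" and a: "a \<in> atoms P" and empty: "join_set P a y = {}" and aQ: "a \<notin> Q"
  have y: "y \<in> carrier P" using yQ Q_carrier by blast
  have aP: "a \<in> carrier P" using a by (rule atom_carrier)
  \<comment> \<open>The orbit of \<open>y\<close> is put first so that the group element acts on
    \<open>y\<close> and the atom \<open>a\<close> stays fixed.\<close>
  have "join_set R (orb y) (orb a) \<noteq> {}"
    using M1 yQ a aQ orb_mem_QR_iff[OF aP] join_set_commute[of R "orb y"]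
    by (auto simp: QR_eq atoms_R)
  then obtain g where g: "g \<in> carrier G" "join_set P (\<phi> g y) a \<noteq> {}"
    using join_set_R_nonempty_iff[OF y aP] by blast
  define q where "q = \<phi> g y"
  have q: "q \<in> carrier P" "q \<in> Q" "rk P q = rk P y"
    \<comment> \<open>Both elements have the rank of their common orbit.\<close>
    using g y yQ Q_invariant act_closed orb_act[of g y] rk_orb[of q] rk_orb[of y]
    by (auto simp: q_def)
  obtain w where w: "w \<in> join_set P q a" using g q_def by blast
  have aq: "\<not> a \<sqsubseteq>\<^bsub>P\<^esub> q" using ideal q aP aQ by (auto simp: order_ideal_def)
  obtain I where I: "I \<subseteq> atoms P" "finite I" "card I = rk P q" "q \<in> min_upper_bounds P I"
    using atom_basis_exists[OF q(1)] by blast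
  note basis = atom_basis_insert[OF I a aq w]
  have wP: "w \<in> carrier P" using w q aP by (simp add: mem_join_set_iff)
  have "rk P y < rk P w" using rk_covers[OF covers_join_atom[OF q(1) a aq w]] q by simp
  then have "\<exists>b\<in>insert a I. \<not> b \<sqsubseteq>\<^bsub>P\<^esub> y \<and> join_set P b y \<noteq> {}"
    using dagger[unfolded double_dagger_condition_def, rule_format, OF y wP, of "insert a I"]
      basis I a by simp
  \<comment> \<open>The atom returned cannot be \<open>a\<close>, whose join with \<open>y\<close>
    is empty, so it belongs to the basis of \<open>q\<close>.\<close>
  then obtain b where b: "b \<in> I" "\<not> b \<sqsubseteq>\<^bsub>P\<^esub> y" "join_set P b y \<noteq> {}" using empty by auto
  have bP: "b \<in> carrier P" using b I atom_carrier by blast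
  have "I \<subseteq> carrier P" using I atom_carrier by blast
  then have bq: "b \<sqsubseteq>\<^bsub>P\<^esub> q" using I(4) b(1) by (simp add: mem_min_upper_bounds_iff)
  obtain u where u: "u \<in> carrier P" "b \<sqsubseteq>\<^bsub>P\<^esub> u" "y \<sqsubseteq>\<^bsub>P\<^esub> u"
    using b(3) bP y by (auto simp: join_set_nonempty_iff)
  let ?b = "\<phi> (inv\<^bsub>G\<^esub> g) b"
  have "?b \<sqsubseteq>\<^bsub>P\<^esub> \<phi> (inv\<^bsub>G\<^esub> g) q" using bq bP q g by (simp add: act_le_iff)
  then have by': "?b \<sqsubseteq>\<^bsub>P\<^esub> y" using g y by (simp add: q_def act_inv)
  then have "?b \<sqsubseteq>\<^bsub>P\<^esub> u" using u y bP g act_closed le_trans[of ?b y u] by simp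
  then have "?b = b" using act_eq_if_common_upper_bound[of "inv\<^bsub>G\<^esub> g" b u] g bP u by simp
  then show False using by' b(2) by simp
qed

end

theorem theorem4p21:
  fixes P :: "('a, 'm) gorder_scheme" and G :: "('g, 'n) monoid_scheme"
    and \<phi> :: "'g \<Rightarrow> 'a \<Rightarrow> 'a" and Q :: "'a set"
  assumes "locally_geometric P"
    and "translative_action G P \<phi>"
    and "Q \<subseteq> carrier P"
    and "(\<Union>g \<in> carrier G. \<phi> g ` Q) = Q"
  shows "(M_ideal P Q \<longrightarrow> M_ideal (quotient_poset G P \<phi>) (orbits G Q \<phi>)) \<and>
    (double_dagger_condition P \<longrightarrow>
      (M_ideal (quotient_poset G P \<phi>) (orbits G Q \<phi>) \<longrightarrow> M_ideal P Q))"
proof -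
  interpret invariant_subset P G \<phi> Q by unfold_locales (use assms in auto)
  show ?thesis
    unfolding M_ideal_def order_ideal_orbits_iff pure_ideal_orbits_iff join_closed_orbits_iff
      modular_condition_orbits_iff
    using atom_condition_orbits atom_condition_if_orbits by blast
qed

end
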